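(* Let $(\mathbb{L}, I)$ be a set of lines with an incidence relation satisfying Axioms [1]–[4]. Then the following two statements about $(\mathbb{L}, I)$ are equivalent. [P1]: For all pairwise skew lines $u, v, w$ and all distinct lines $a, b, c, d$ in the regulus $[uvw]$, if a line meets three of $a, b, c, d$ then it meets the fourth. [P2]: For all pairwise skew lines $u, v, w$ and all distinct $x, y, z \in [uvw]$, if $l \in [uvw]$ and $m \in [xyz]$ then $l$ meets $m$.
   Context: Framework. $\mathbb{L}$ is a set whose elements are called lines, equipped with a symmetric reflexive relation $I$ called incidence ("$a$ meets $b$" means $a \, I \, b$). For $S \subseteq \mathbb{L}$, $S^{I}$ denotes the set of all lines incident to each line in $S$; write $l^{I} = \{l\}^{I}$, $[l_1 \dots l_n] = \{l_1,\dots,l_n\}^{I}$ and $[ab]^{I} = ([ab])^{I}$. Lines $a, b$ are skew if they are not incident; a skew pair in a set is a pair of skew lines both in the set. The axioms are as follows. Axiom [1]: for each line $l$ the set $l^{I}$ contains three pairwise skew lines. Axiom [2]: for each incident pair of distinct lines $a, b$: [2.1] $[ab]$ contains skew pairs of lines; [2.2] if $c \in [ab] \setminus [ab]^{I}$ (i.e. $c$ is one of a skew pair in $[ab]$) then $[abc]$ contains no skew pairs; [2.3] if $x, y$ is a skew pair in $[ab]$ then $[ab] = [abx] \cup [aby]$. Axiom [3]: if $a, b$ is an incident pair of distinct lines and $c \in [ab] \setminus [ab]^{I}$, then there exist an incident pair of distinct lines $p, q$ and $r \in [pq] \setminus [pq]^{I}$ such that $[abc] \cap [pqr] = \emptyset$.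 Points and planes: for distinct incident $a, b$, incidence restricts to an equivalence relation on $\Sigma(a,b) = [ab] \setminus [ab]^{I}$ with exactly two classes. These classes are labelled $\Sigma_{\curlyvee}(a,b)$ and $\Sigma_{\triangledown}(a,b)$ (one labelling fixed for each unordered pair $\{a,b\}$, so that Axiom [4] holds). The set $a \curlyvee b = [abc]$ for any $c \in \Sigma_{\curlyvee}(a,b)$ is independent of the choice of $c$ and is called a point; the set $a \triangledown b = [abc]$ for any $c \in \Sigma_{\triangledown}(a,b)$ is independent of the choice of $c$ and is called a plane. Axiom [4]: whenever $a, b$ and $p, q$ are pairs of distinct incident lines, $(a \curlyvee b) \cap (p \curlyvee q) \neq \emptyset$ and $(a \triangledown b) \cap (p \triangledown q) \neq \emptyset$. Regulus: for pairwise skew lines $u, v, w$, the set $[uvw]$ is called a regulus. Distinct lines in a regulus are necessarily skew. *)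

theory Defs
  imports Main
begin

text \<open>
  Lines are the members of a carrier set \<open>L\<close>; the incidence relation \<open>I\<close> is only ever
  considered on \<open>L\<close>. We write \<open>perp L I S\<close> for the set of lines that meet every line in \<open>S\<close>,
  so that \<open>perp L I {a, b}\<close> is \<open>[ab]\<close>.
\<close>

definition perp :: "'a set \<Rightarrow> ('a \<Rightarrow> 'a \<Rightarrow> bool) \<Rightarrow> 'a set \<Rightarrow> 'a set" where
  "perp L I S = {x \<in> L. \<forall>s\<in>S. I x s}"

definition has_skew_pair :: "('a \<Rightarrow> 'a \<Rightarrow> bool) \<Rightarrow> 'a set \<Rightarrow> bool" where
  "has_skew_pair I S \<longleftrightarrow> (\<exists>x\<in>S. \<exists>y\<in>S. \<not> I x y)"

text \<open>
  For reflexive \<open>I\<close> this forces \<open>u\<close>, \<open>v\<close>, \<open>w\<close> to be distinct, which \<open>pairwise\<close>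
  on the set \<open>{u, v, w}\<close> would not.
\<close>

definition skew3 :: "('a \<Rightarrow> 'a \<Rightarrow> bool) \<Rightarrow> 'a \<Rightarrow> 'a \<Rightarrow> 'a \<Rightarrow> bool" where
  "skew3 I u v w \<longleftrightarrow> \<not> I u v \<and> \<not> I v w \<and> \<not> I u w"

text \<open>This set is called a regulus only when \<open>u\<close>, \<open>v\<close>, \<open>w\<close> are pairwise skew.\<close>

definition regulus :: "'a set \<Rightarrow> ('a \<Rightarrow> 'a \<Rightarrow> bool) \<Rightarrow> 'a \<Rightarrow> 'a \<Rightarrow> 'a \<Rightarrow> 'a set" where
  "regulus L I u v w = perp L I {u, v, w}"

definition incident_pair :: "'a set \<Rightarrow> ('a \<Rightarrow> 'a \<Rightarrow> bool) \<Rightarrow> 'a \<Rightarrow> 'a \<Rightarrow> bool" where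
  "incident_pair L I a b \<longleftrightarrow> a \<in> L \<and> b \<in> L \<and> a \<noteq> b \<and> I a b"

definition Sig :: "'a set \<Rightarrow> ('a \<Rightarrow> 'a \<Rightarrow> bool) \<Rightarrow> 'a \<Rightarrow> 'a \<Rightarrow> 'a set" where
  "Sig L I a b = perp L I {a, b} - perp L I (perp L I {a, b})"

definition Sig_rel :: "'a set \<Rightarrow> ('a \<Rightarrow> 'a \<Rightarrow> bool) \<Rightarrow> 'a \<Rightarrow> 'a \<Rightarrow> ('a \<times> 'a) set" where
  "Sig_rel L I a b = {(x, y). x \<in> Sig L I a b \<and> y \<in> Sig L I a b \<and> I x y}"

text \<open>
  The set \<open>[abc]\<close> for any \<open>c\<close> in the class \<open>S a b\<close>; it does not depend on the chosen \<open>c\<close>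
  when \<open>S a b\<close> is one of the classes of \<open>Sig_rel L I a b\<close>, see \<open>span_of_eq\<close> below.
\<close>

definition span_of ::
  "'a set \<Rightarrow> ('a \<Rightarrow> 'a \<Rightarrow> bool) \<Rightarrow> ('a \<Rightarrow> 'a \<Rightarrow> 'a set) \<Rightarrow> 'a \<Rightarrow> 'a \<Rightarrow> 'a set" where
  "span_of L I S a b = perp L I {a, b, SOME c. c \<in> S a b}"

locale line_incidence =
  fixes L :: "'a set" and I :: "'a \<Rightarrow> 'a \<Rightarrow> bool"
  assumes I_refl: "a \<in> L \<Longrightarrow> I a a"
    and I_sym: "\<lbrakk>a \<in> L; b \<in> L; I a b\<rbrakk> \<Longrightarrow> I b a"
    and axiom1: "l \<in> L \<Longrightarrow>
      \<exists>x\<in>perp L I {l}. \<exists>y\<in>perp L I {l}. \<exists>z\<in>perp L I {l}. skew3 I x y z"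
    and axiom2_1: "incident_pair L I a b \<Longrightarrow> has_skew_pair I (perp L I {a, b})"
    and axiom2_2: "\<lbrakk>incident_pair L I a b; c \<in> Sig L I a b\<rbrakk>
      \<Longrightarrow> \<not> has_skew_pair I (perp L I {a, b, c})"
    and axiom2_3: "\<lbrakk>incident_pair L I a b; x \<in> perp L I {a, b}; y \<in> perp L I {a, b}; \<not> I x y\<rbrakk>
      \<Longrightarrow> perp L I {a, b} = perp L I {a, b, x} \<union> perp L I {a, b, y}"
    and axiom3: "\<lbrakk>incident_pair L I a b; c \<in> Sig L I a b\<rbrakk>
      \<Longrightarrow> \<exists>p q r. incident_pair L I p q \<and> r \<in> Sig L I p q \<and>
            perp L I {a, b, c} \<inter> perp L I {p, q, r} = {}"
begin

lemma equiv_Sig_rel: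
  assumes "incident_pair L I a b"
  shows "equiv (Sig L I a b) (Sig_rel L I a b)"
proof (rule equivI)
  show "Sig_rel L I a b \<subseteq> Sig L I a b \<times> Sig L I a b"
    by (auto simp: Sig_rel_def)
  show "refl_on (Sig L I a b) (Sig_rel L I a b)"
    using I_refl by (simp add: refl_on_def Sig_rel_def Sig_def perp_def)
  show "sym (Sig_rel L I a b)"
    using I_sym by (simp add: sym_def Sig_rel_def Sig_def perp_def)
  show "trans (Sig_rel L I a b)"
  proof (rule transI)
    fix x y z
    assume "(x, y) \<in> Sig_rel L I a b" "(y, z) \<in> Sig_rel L I a b"
    then have S: "x \<in> Sig L I a b" "y \<in> Sig L I a b" "z \<in> Sig L I a b" and xy: "I x y" and yz: "I y z"
      by (auto simp: Sig_rel_def)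
    then have "x \<in> perp L I {a, b, y}" "z \<in> perp L I {a, b, y}"
      using I_sym[of y z] by (auto simp: Sig_def perp_def)
    then have "I x z"
      using axiom2_2[OF assms S(2)] by (auto simp: has_skew_pair_def)
    then show "(x, z) \<in> Sig_rel L I a b"
      using S by (auto simp: Sig_rel_def)
  qed
qed

lemma card_Sig_quotient:
  assumes ab: "incident_pair L I a b"
  shows "card (Sig L I a b // Sig_rel L I a b) = 2"
proof -
  let ?S = "Sig L I a b" and ?R = "Sig_rel L I a b"
  have eq: "equiv ?S ?R" by (rule equiv_Sig_rel[OF ab])
  obtain x y where x: "x \<in> perp L I {a, b}" and y: "y \<in> perp L I {a, b}" and xy: "\<not> I x y"
    using axiom2_1[OF ab] by (auto simp: has_skew_pair_def)
  then have "\<not> I y x"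
    using I_sym[of y x] by (auto simp: perp_def)
  then have xS: "x \<in> ?S" and yS: "y \<in> ?S"
    using x y xy unfolding Sig_def perp_def by blast+
  have "z \<in> ?R `` {x} \<or> z \<in> ?R `` {y}" if z: "z \<in> ?S" for z
  proof -
    have "I z x \<or> I z y"
      using z axiom2_3[OF ab x y xy] by (auto simp: Sig_def perp_def)
    moreover have "x \<in> L" "y \<in> L" "z \<in> L"
      using x y z by (simp_all add: Sig_def perp_def)
    ultimately show ?thesis
      using z xS yS I_sym[of z x] I_sym[of z y] by (auto simp: Sig_rel_def)
  qed
  then have "?R `` {z} \<in> {?R `` {x}, ?R `` {y}}" if "z \<in> ?S" for z
    using that equiv_class_eq[OF eq, of x z] equiv_class_eq[OF eq, of y z] by blast
  then have "?S // ?R = {?R `` {x}, ?R `` {y}}"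
    using quotientI[OF xS, of ?R] quotientI[OF yS, of ?R]
    by (intro subset_antisym subsetI) (blast elim: quotientE)+
  moreover have "?R `` {x} \<noteq> ?R `` {y}"
    using eq_equiv_class[OF _ eq yS, of x] xy by (auto simp: Sig_rel_def)
  ultimately show ?thesis by simp
qed

end

text \<open>
  A labelling of the two classes of each \<open>\<Sigma>(a,b)\<close> is part of the structure:
  \<open>P a b\<close> is the class that yields points and \<open>T a b\<close> the class that yields planes.
  Their values are irrelevant when \<open>a\<close>, \<open>b\<close> are not distinct incident lines.
\<close>

locale line_geometry = line_incidence L I
  for L :: "'a set" and I :: "'a \<Rightarrow> 'a \<Rightarrow> bool" +
  fixes P T :: "'a \<Rightarrow> 'a \<Rightarrow> 'a set"
  assumes label_classes:
      "incident_pair L I a b \<Longrightarrow> Sig L I a b // Sig_rel L I a b = {P a b, T a b}"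
    and label_sym: "incident_pair L I a b \<Longrightarrow> P a b = P b a \<and> T a b = T b a"
    and axiom4: "\<lbrakk>incident_pair L I a b; incident_pair L I p q\<rbrakk>
      \<Longrightarrow> span_of L I P a b \<inter> span_of L I P p q \<noteq> {} \<and>
          span_of L I T a b \<inter> span_of L I T p q \<noteq> {}"
begin

lemma label_distinct:
  assumes "incident_pair L I a b"
  shows "P a b \<noteq> T a b"
  using card_Sig_quotient[OF assms] label_classes[OF assms] by auto

lemma span_of_eq:
  assumes ab: "incident_pair L I a b"
    and S: "S a b \<in> Sig L I a b // Sig_rel L I a b"
    and c: "c \<in> S a b"
  shows "span_of L I S a b = perp L I {a, b, c}"
proof -
  have sub: "perp L I {a, b, c} \<subseteq> perp L I {a, b, d}" if cd: "c \<in> S a b" "d \<in> S a b" for c d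
  proof
    fix z assume z: "z \<in> perp L I {a, b, c}"
    have cd': "(d, c) \<in> Sig_rel L I a b"
      using quotient_eq_iff[OF equiv_Sig_rel[OF ab] S S cd(2,1)] by simp
    then have "d \<in> perp L I {a, b, c}" "c \<in> Sig L I a b"
      by (auto simp: Sig_rel_def Sig_def perp_def)
    then have "I z d"
      using z axiom2_2[OF ab] by (auto simp: has_skew_pair_def)
    then show "z \<in> perp L I {a, b, d}"
      using z by (auto simp: perp_def)
  qed
  have "(SOME c. c \<in> S a b) \<in> S a b"
    using c by (rule someI)
  then show ?thesis
    using sub c unfolding span_of_def by blast
qed

end

end

theory Submission
  imports Defs
begin

text \<open>
  Both properties say, one regulus at a time, that a line meeting three lines of the regulus
  meets all of them, so the equivalence already holds for each set of lines separately.
  In the first property the line \<open>m\<close> meets three members and the fourth one is the member \<open>l\<close> of the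
  second property. The case where \<open>l\<close> is itself one of the three lines that \<open>m\<close> is known to meet
  only occurs in the second property, and there it is immediate.
\<close>

lemma (in line_incidence) meets_fourth_iff_meets_all:
  assumes "R \<subseteq> L"
  shows "(\<forall>a\<in>R. \<forall>b\<in>R. \<forall>c\<in>R. \<forall>d\<in>R. distinct [a, b, c, d] \<longrightarrow>
            (\<forall>m\<in>L. \<forall>t\<in>{a, b, c, d}. (\<forall>s\<in>{a, b, c, d} - {t}. I m s) \<longrightarrow> I m t))
         \<longleftrightarrow>
         (\<forall>x\<in>R. \<forall>y\<in>R. \<forall>z\<in>R. distinct [x, y, z] \<longrightarrow>
            (\<forall>l\<in>R. \<forall>m\<in>perp L I {x, y, z}. I l m))"
    (is "?fourth \<longleftrightarrow> ?all")
proof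
  assume fourth: ?fourth
  show ?all
  proof (intro ballI impI)
    fix x y z l m
    assume R: "x \<in> R" "y \<in> R" "z \<in> R" "l \<in> R" and dist: "distinct [x, y, z]"
      and "m \<in> perp L I {x, y, z}"
    then have m: "m \<in> L" "I m x" "I m y" "I m z"
      by (auto simp: perp_def)
    have "I m l"
    proof (cases "l \<in> {x, y, z}")
      case True
      then show ?thesis using m by auto
    next
      case False
      then have "distinct [x, y, z, l]" using dist by auto
      then have "(\<forall>s\<in>{x, y, z, l} - {l}. I m s) \<longrightarrow> I m l"
        using fourth R m(1) by blast
      then show ?thesis using m by blast
    qed
    then show "I l m"
      using I_sym m(1) R(4) assms by blast
  qed
next
  assume all: ?all
  have meets: "I m l"
    if "x \<in> R" "y \<in> R" "z \<in> R" "l \<in> R" "distinct [x, y, z]" "m \<in> L" "I m x" "I m y" "I m z"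
    for x y z l m
  proof -
    have "I l m" using all that by (simp add: perp_def)
    then show ?thesis using I_sym that assms by blast
  qed
  show ?fourth
  proof (intro ballI impI)
    fix a b c d m t
    assume R: "a \<in> R" "b \<in> R" "c \<in> R" "d \<in> R" and dist: "distinct [a, b, c, d]"
      and m: "m \<in> L" and t: "t \<in> {a, b, c, d}" and three: "\<forall>s\<in>{a, b, c, d} - {t}. I m s"
    consider "t = a" | "t = b" | "t = c" | "t = d" using t by blast
    then show "I m t"
    proof cases
      case 1 then show ?thesis using meets[of b c d t m] R dist m three by auto
    next
      case 2 then show ?thesis using meets[of a c d t m] R dist m three by auto
    next
      case 3 then show ?thesis using meets[of a b d t m] R dist m three by auto
    next
      case 4 then show ?thesis using meets[of a b c t m] R dist m three by auto
    qed
  qed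
qed

theorem theorem6:
  fixes L :: "'a set" and I :: "'a \<Rightarrow> 'a \<Rightarrow> bool" and P T :: "'a \<Rightarrow> 'a \<Rightarrow> 'a set"
  assumes "line_geometry L I P T"
  shows "(\<forall>u\<in>L. \<forall>v\<in>L. \<forall>w\<in>L. skew3 I u v w \<longrightarrow>
            (\<forall>a\<in>regulus L I u v w. \<forall>b\<in>regulus L I u v w.
             \<forall>c\<in>regulus L I u v w. \<forall>d\<in>regulus L I u v w. distinct [a, b, c, d] \<longrightarrow>
               (\<forall>m\<in>L. \<forall>t\<in>{a, b, c, d}. (\<forall>s\<in>{a, b, c, d} - {t}. I m s) \<longrightarrow> I m t)))
         \<longleftrightarrow>
         (\<forall>u\<in>L. \<forall>v\<in>L. \<forall>w\<in>L. skew3 I u v w \<longrightarrow>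
            (\<forall>x\<in>regulus L I u v w. \<forall>y\<in>regulus L I u v w. \<forall>z\<in>regulus L I u v w.
               distinct [x, y, z] \<longrightarrow>
               (\<forall>l\<in>regulus L I u v w. \<forall>m\<in>perp L I {x, y, z}. I l m)))"
proof -
  interpret line_geometry L I P T by (rule assms)
  have "regulus L I u v w \<subseteq> L" for u v w
    by (auto simp: regulus_def perp_def)
  then show ?thesis
    by (simp only: meets_fourth_iff_meets_all)
qed

end
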